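(* Let $I\subset\mathbb{R}$ be an open interval. For twice differentiable $\mathbf{X}=(x_1,\dots,x_{N_p})^\top:I\to\mathbb{R}^{N_p}$ and $\boldsymbol\phi=(\phi_1,\dots,\phi_N)^\top:I\to\mathbb{R}^N$, consider the system (obtained by discretizing the action integral) $$\ddot{x}_k = Z\sum_{j=1}^N \Delta x\, S'(\xi_j-x_k)\,\phi_j,\qquad k=1,\dots,N_p,\tag{A1}$$ $$-Z\sum_{k=1}^{N_p} w_k S(\xi_j-x_k) + (\mathbb{A}\boldsymbol\phi)_j + n_0(\xi_j)\exp\left(\frac{\phi_j-\phi_0(\xi_j)}{T_e(\xi_j)}\right)=0,\qquad j=1,\dots,N.\tag{A2}$$ For differentiable $\mathbf{X},\mathbf{V}:I\to\mathbb{R}^{N_p}$, with $\mathbf{V}=(v_1,\dots,v_{N_p})^\top$, consider the Hamiltonian system (obtained by discretizing the Poisson bracket) $$\dot{x}_k=\frac{1}{w_k}\,\partial_{v_k}H(\mathbf{X},\mathbf{V}),\qquad \dot{v}_k=-\frac{1}{w_k}\,\partial_{x_k}H(\mathbf{X},\mathbf{V}),\qquad k=1,\dots,N_p,\tag{B}$$ where $$H(\mathbf{X},\mathbf{V})=-\frac12\,\boldsymbol\phi^\top\mathbb{A}\boldsymbol\phi\,\Delta x+Z\sum_{j=1}^N\Delta x\sum_{k=1}^{N_p}w_kS(\xi_j-x_k)\phi_j+\frac12\sum_{k=1}^{N_p}w_kv_k^2-\sum_{j=1}^N\Delta x\,T_e(\xi_j)\,n_0(\xi_j)\exp\left(\frac{\phi_j-\phi_0(\xi_j)}{T_e(\xi_j)}\right),$$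 and in $H$ the vector $\boldsymbol\phi=\boldsymbol\phi(\mathbf{X})$ is the function of $\mathbf{X}$ determined by the discrete Poisson--Boltzmann equation (A2). Then the two systems are equivalent: if $(\mathbf{X},\mathbf{V})$ solves (B) on $I$, then $\mathbf{V}=\dot{\mathbf{X}}$ and $(\mathbf{X},\boldsymbol\phi(\mathbf{X}))$ solves (A1)--(A2) on $I$; conversely, if $(\mathbf{X},\boldsymbol\phi)$ solves (A1)--(A2) on $I$, then $\boldsymbol\phi=\boldsymbol\phi(\mathbf{X})$ and $(\mathbf{X},\dot{\mathbf{X}})$ solves (B) on $I$.
   Context: Setting: a particle-in-cell / finite-difference discretization, in one space dimension with periodic boundary conditions, of the hybrid plasma model $\partial_t f+v\,\partial_xf-Z\,\partial_x\phi\,\partial_vf=0$, $-\partial_x^2\phi=Z\int f\,dv-n_0\exp((\phi-\phi_0)/T_e)$. Notation: $N\ge 3$ is the number of grid points, $N_p\geq 1$ the number of particles, $L>0$ the period, $\Delta x=L/N$, and $\xi_1,\dots,\xi_N$ (with $\xi_{j+1}=\xi_j+\Delta x$) is a uniform grid on the periodic domain. $Z>0$ is a constant (ion charge number), $w_k>0$ ($k=1,\dots,N_p$) are constant particle weights, $x_k,v_k\in\mathbb{R}$ are the particle positions and velocities. $S:\mathbb{R}\to\mathbb{R}$ is the particle shape function (typically a B-spline), taken to be $L$-periodic (periodized) and continuously differentiable, with derivative $S'$. $n_0,\phi_0,T_e$ are given time-independent real functions on the grid, with $n_0(\xi_j)>0$ and $T_e(\xi_j)>0$. $\mathbb{A}$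 is the $N\times N$ symmetric periodic finite-difference matrix of $-\partial_x^2$: $(\mathbb{A}\boldsymbol\phi)_j=\dfrac{2\phi_j-\phi_{j+1}-\phi_{j-1}}{\Delta x^2}$, with indices modulo $N$. Standing assumption: the potential is determined by the particles, i.e. for each $\mathbf{X}\in\mathbb{R}^{N_p}$ the equation (A2) has a unique solution $\boldsymbol\phi(\mathbf{X})\in\mathbb{R}^N$, and it depends differentiably on $\mathbf{X}$.
   Formalization: In (A1)–(A2) φ is only required to be differentiable, not twice differentiable: for S merely C¹, φ(X(t)) need not be twice differentiable. That φ(X(t)) is twice differentiable is proved when X ↦ φ(X) is twice differentiable. *)

theory Defs
  imports "HOL-Analysis.Analysis" "Berlekamp_Zassenhaus.Finite_Field"
begin

text \<open>
  Grid functions are vectors indexed by the type \<open>'n mod_ring\<close> of integers modulo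
  \<open>N = CARD('n)\<close>, so that \<open>j + 1\<close> and \<open>j - 1\<close> are the neighbours of the grid index \<open>j\<close> with
  periodic wrap-around; the index \<open>N\<close> is the residue class \<open>0\<close>.
  Particle vectors are indexed by an arbitrary finite type \<open>'p\<close>.
\<close>

definition fd_matrix :: "real \<Rightarrow> real ^ ('n::nontriv mod_ring) ^ ('n mod_ring)" where
  "fd_matrix dx = matrix (\<lambda>\<phi>. \<chi> j. (2 * \<phi> $ j - \<phi> $ (j + 1) - \<phi> $ (j - 1)) / dx\<^sup>2)"

lemma fd_matrix_mult:
  "(fd_matrix dx *v \<phi>) $ j = (2 * \<phi> $ j - \<phi> $ (j + 1) - \<phi> $ (j - 1)) / dx\<^sup>2"
proof -
  have "linear (\<lambda>\<phi>::real ^ ('n::nontriv mod_ring).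
      \<chi> j. (2 * \<phi> $ j - \<phi> $ (j + 1) - \<phi> $ (j - 1)) / dx\<^sup>2)"
    by (rule linearI)
      (simp_all add: vec_eq_iff add_divide_distrib diff_divide_distrib algebra_simps)
  from fun_cong[OF matrix_vector_mul(2)[OF this], of \<phi>] show ?thesis
    unfolding fd_matrix_def by simp
qed

definition grid_step :: "real \<Rightarrow> 'n::nontriv itself \<Rightarrow> real" where
  "grid_step L _ = L / real CARD('n)"

definition discrete_poisson_boltzmann ::
  "real \<Rightarrow> real \<Rightarrow> real ^ 'p \<Rightarrow> (real \<Rightarrow> real) \<Rightarrow> ('n::nontriv mod_ring \<Rightarrow> real) \<Rightarrow>
   (real \<Rightarrow> real) \<Rightarrow> (real \<Rightarrow> real) \<Rightarrow> (real \<Rightarrow> real) \<Rightarrow>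
   real ^ 'p \<Rightarrow> real ^ 'n mod_ring \<Rightarrow> bool" where
  "discrete_poisson_boltzmann L Z w S \<xi> n0 \<phi>0 Te X \<phi> \<longleftrightarrow>
    (\<forall>j. - Z * (\<Sum>k\<in>UNIV. w $ k * S (\<xi> j - X $ k))
         + (fd_matrix (grid_step L TYPE('n)) *v \<phi>) $ j
         + n0 (\<xi> j) * exp ((\<phi> $ j - \<phi>0 (\<xi> j)) / Te (\<xi> j)) = 0)"

text \<open>The argument \<open>\<Phi>\<close> is the map sending particle positions to the potential.\<close>

definition hamiltonian ::
  "real \<Rightarrow> real \<Rightarrow> real ^ 'p \<Rightarrow> (real \<Rightarrow> real) \<Rightarrow> ('n::nontriv mod_ring \<Rightarrow> real) \<Rightarrow>
   (real \<Rightarrow> real) \<Rightarrow> (real \<Rightarrow> real) \<Rightarrow> (real \<Rightarrow> real) \<Rightarrow>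
   (real ^ 'p \<Rightarrow> real ^ 'n mod_ring) \<Rightarrow> real ^ 'p \<Rightarrow> real ^ 'p \<Rightarrow> real" where
  "hamiltonian L Z w S \<xi> n0 \<phi>0 Te \<Phi> X V =
    (let dx = grid_step L TYPE('n); \<phi> = \<Phi> X in
      - (1 / 2) * (\<phi> \<bullet> (fd_matrix dx *v \<phi>)) * dx
      + Z * (\<Sum>j\<in>UNIV. dx * (\<Sum>k\<in>UNIV. w $ k * S (\<xi> j - X $ k) * \<phi> $ j))
      + (1 / 2) * (\<Sum>k\<in>UNIV. w $ k * (V $ k)\<^sup>2)
      - (\<Sum>j\<in>UNIV. dx * Te (\<xi> j) * n0 (\<xi> j) * exp ((\<phi> $ j - \<phi>0 (\<xi> j)) / Te (\<xi> j))))"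

definition partial_deriv :: "(real ^ 'p \<Rightarrow> real) \<Rightarrow> 'p \<Rightarrow> real ^ 'p \<Rightarrow> real" where
  "partial_deriv f k x = deriv (\<lambda>s. f (x + s *\<^sub>R axis k 1)) 0"

definition twice_differentiable_on ::
  "('a::real_normed_vector \<Rightarrow> 'b::real_normed_vector) \<Rightarrow> 'a set \<Rightarrow> bool" where
  "twice_differentiable_on f U \<longleftrightarrow>
    (\<exists>D :: 'a \<Rightarrow> 'a \<Rightarrow>\<^sub>L 'b.
       (\<forall>x\<in>U. (f has_derivative blinfun_apply (D x)) (at x)) \<and>
       (\<forall>x\<in>U. D differentiable (at x)))"

text \<open>
  The potential enters this system without time derivatives and is only required to be
  differentiable. The stronger requirement that it be twice differentiable can fail for
  \<open>\<Phi> \<circ> X\<close> when the shape function is merely continuously differentiable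
  (e.g. a quadratic B-spline).
\<close>

definition solves_variational ::
  "real \<Rightarrow> real \<Rightarrow> real ^ 'p \<Rightarrow> (real \<Rightarrow> real) \<Rightarrow> (real \<Rightarrow> real) \<Rightarrow>
   ('n::nontriv mod_ring \<Rightarrow> real) \<Rightarrow> (real \<Rightarrow> real) \<Rightarrow> (real \<Rightarrow> real) \<Rightarrow> (real \<Rightarrow> real) \<Rightarrow>
   real set \<Rightarrow> (real \<Rightarrow> real ^ 'p) \<Rightarrow> (real \<Rightarrow> real ^ 'n mod_ring) \<Rightarrow> bool" where
  "solves_variational L Z w S S' \<xi> n0 \<phi>0 Te I X \<phi> \<longleftrightarrow>
    twice_differentiable_on X I \<and> (\<forall>t\<in>I. \<phi> differentiable (at t)) \<and>
    (\<forall>t\<in>I.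
      (\<forall>k. vector_derivative (\<lambda>s. vector_derivative X (at s)) (at t) $ k =
            Z * (\<Sum>j\<in>UNIV. grid_step L TYPE('n) * S' (\<xi> j - X t $ k) * \<phi> t $ j)) \<and>
      discrete_poisson_boltzmann L Z w S \<xi> n0 \<phi>0 Te (X t) (\<phi> t))"

definition solves_hamiltonian ::
  "real ^ 'p \<Rightarrow> (real ^ 'p \<Rightarrow> real ^ 'p \<Rightarrow> real) \<Rightarrow>
   real set \<Rightarrow> (real \<Rightarrow> real ^ 'p) \<Rightarrow> (real \<Rightarrow> real ^ 'p) \<Rightarrow> bool" where
  "solves_hamiltonian w H I X V \<longleftrightarrow>
    (\<forall>t\<in>I. X differentiable (at t) \<and> V differentiable (at t) \<and>
      (\<forall>k. vector_derivative X (at t) $ k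
             = 1 / w $ k * partial_deriv (\<lambda>v. H (X t) v) k (V t) \<and>
           vector_derivative V (at t) $ k
             = - (1 / w $ k) * partial_deriv (\<lambda>x. H x (V t)) k (X t)))"

end

theory Submission
  imports Defs
begin

text \<open>
  Let \<open>F(\<phi>, X)\<close> be the potential part of the Hamiltonian with \<open>\<phi>\<close> regarded as a free variable.
  Since the finite-difference matrix is symmetric, the gradient of \<open>F\<close> in \<open>\<phi>\<close> is \<open>- \<Delta>x\<close> times the
  left-hand side of the discrete Poisson--Boltzmann equation: the potential \<open>\<Phi> X\<close> is a critical
  point of \<open>F(\<cdot>, X)\<close>. Hence, when \<open>F(\<Phi> X, X)\<close> is differentiated in \<open>x\<^sub>k\<close>, the chain-rule term that
  contains the unknown derivative of \<open>\<Phi>\<close> vanishes, and only the explicit dependence on \<open>x\<^sub>k\<close>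
  through the shape function is left (\<open>partial_deriv_hamiltonian_position\<close>). It is \<open>- w\<^sub>k\<close> times the
  right-hand side of Newton's equation for particle \<open>k\<close>. As the kinetic part gives
  \<open>\<partial>H/\<partial>v\<^sub>k = w\<^sub>k v\<^sub>k\<close>, Hamilton's equations are the first-order form \<open>X' = V\<close>, \<open>V' = force\<close> of
  Newton's equations (\<open>solves_hamiltonian_iff_first_order\<close>).

  The rest of the equivalence concerns regularity: on an open interval, being twice differentiable
  is the same as having a differentiable velocity, and the potential in the variational system has
  to be \<open>\<Phi> \<circ> X\<close> because the Poisson--Boltzmann equation has only one solution.
\<close>

text \<open>
  Summation by parts on a periodic grid: \<open>j \<mapsto> j + 1\<close> permutes the residue classes, so each shift
  can be moved to the other factor.
\<close>

lemma fd_matrix_self_adjoint: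
  fixes \<phi> \<psi> :: "real ^ ('n::nontriv mod_ring)"
  shows "\<phi> \<bullet> (fd_matrix dx *v \<psi>) = (fd_matrix dx *v \<phi>) \<bullet> \<psi>"
proof -
  have shift: "(\<Sum>j\<in>UNIV. u $ j * v $ (j + 1)) = (\<Sum>j\<in>UNIV. u $ (j - 1) * v $ j)"
    for u v :: "real ^ 'n mod_ring"
    by (rule sum.reindex_bij_witness[of _ "\<lambda>j. j - 1" "\<lambda>j. j + 1"]) auto
  have "\<phi> \<bullet> (fd_matrix dx *v \<psi>) =
      (2 * (\<Sum>j\<in>UNIV. \<phi> $ j * \<psi> $ j) - (\<Sum>j\<in>UNIV. \<phi> $ j * \<psi> $ (j + 1))
        - (\<Sum>j\<in>UNIV. \<phi> $ j * \<psi> $ (j - 1))) / dx\<^sup>2"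
    unfolding inner_vec_def fd_matrix_mult inner_real_def sum_distrib_left
      sum_subtractf[symmetric] sum_divide_distrib
    by (intro sum.cong refl) (simp add: algebra_simps)
  also have "\<dots> = (2 * (\<Sum>j\<in>UNIV. \<phi> $ j * \<psi> $ j) - (\<Sum>j\<in>UNIV. \<phi> $ (j - 1) * \<psi> $ j)
        - (\<Sum>j\<in>UNIV. \<phi> $ (j + 1) * \<psi> $ j)) / dx\<^sup>2"
    using shift[of \<phi> \<psi>] shift[of \<psi> \<phi>] by (simp add: mult.commute)
  also have "\<dots> = (fd_matrix dx *v \<phi>) \<bullet> \<psi>"
    unfolding inner_vec_def fd_matrix_mult inner_real_def sum_distrib_left
      sum_subtractf[symmetric] sum_divide_distrib
    by (intro sum.cong refl) (simp add: algebra_simps)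
  finally show ?thesis .
qed

text \<open>
  The factor \<open>2\<close> comes from self-adjointness, which identifies the two terms of the product rule.
\<close>

lemma has_derivative_fd_energy:
  fixes \<phi> :: "real \<Rightarrow> real ^ ('n::nontriv mod_ring)"
  assumes "(\<phi> has_vector_derivative \<psi>) (at t)"
  shows "((\<lambda>s. \<phi> s \<bullet> (fd_matrix dx *v \<phi> s)) has_real_derivative
           2 * (\<psi> \<bullet> (fd_matrix dx *v \<phi> t))) (at t)"
proof -
  have A: "((\<lambda>s. fd_matrix dx *v \<phi> s) has_vector_derivative fd_matrix dx *v \<psi>) (at t)"
    by (rule bounded_linear.has_vector_derivative[OF matrix_vector_mul_bounded_linear assms])
  have "((\<lambda>s. \<phi> s \<bullet> (fd_matrix dx *v \<phi> s)) has_vector_derivative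
          \<phi> t \<bullet> (fd_matrix dx *v \<psi>) + \<psi> \<bullet> (fd_matrix dx *v \<phi> t)) (at t)"
    by (rule bounded_bilinear.has_vector_derivative[OF bounded_bilinear_inner assms A])
  moreover have "\<phi> t \<bullet> (fd_matrix dx *v \<psi>) = \<psi> \<bullet> (fd_matrix dx *v \<phi> t)"
    using fd_matrix_self_adjoint[of "\<phi> t" dx \<psi>] by (simp add: inner_commute)
  ultimately show ?thesis
    by (simp add: has_real_derivative_iff_has_vector_derivative)
qed

lemma partial_deriv_hamiltonian_velocity:
  "partial_deriv (\<lambda>v. hamiltonian L Z w S \<xi> n0 \<phi>0 Te \<Phi> X v) k V = w $ k * V $ k"
proof -
  have "((\<lambda>s. hamiltonian L Z w S \<xi> n0 \<phi>0 Te \<Phi> X (V + s *\<^sub>R axis k 1)) has_real_derivative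
          (1 / 2) * (\<Sum>l\<in>UNIV. w $ l * (2 * V $ l * (axis k 1 $ l)))) (at 0)"
    unfolding hamiltonian_def Let_def
    by (auto intro!: derivative_eq_intros simp: algebra_simps)
  moreover have "(1 / 2) * (\<Sum>l\<in>UNIV. w $ l * (2 * V $ l * (axis k 1 $ l))) = w $ k * V $ k"
    by (simp add: axis_def if_distrib[of "\<lambda>x. _ * x"] cong: if_cong)
  ultimately show ?thesis
    unfolding partial_deriv_def by (simp add: DERIV_imp_deriv)
qed

text \<open>
  The derivative of \<open>\<Phi>\<close> is absent from the result: it enters only as a factor of the residual of
  the Poisson--Boltzmann equation at \<open>\<Phi> X\<close>, which is zero.
\<close>

lemma partial_deriv_hamiltonian_position:
  fixes \<xi> :: "'n::nontriv mod_ring \<Rightarrow> real"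
    and \<Phi> :: "real ^ 'p \<Rightarrow> real ^ 'n mod_ring"
  assumes S: "\<And>x. (S has_real_derivative S' x) (at x)"
    and Te: "\<And>j. Te (\<xi> j) \<noteq> 0"
    and PB: "discrete_poisson_boltzmann L Z w S \<xi> n0 \<phi>0 Te X (\<Phi> X)"
    and diff: "\<Phi> differentiable (at X)"
  shows "partial_deriv (\<lambda>x. hamiltonian L Z w S \<xi> n0 \<phi>0 Te \<Phi> x V) k X =
          - (w $ k) * (Z * (\<Sum>j\<in>UNIV. grid_step L TYPE('n) * S' (\<xi> j - X $ k) * \<Phi> X $ j))"
proof -
  define dx where "dx = grid_step L TYPE('n)"
  define x where "x = (\<lambda>s. X + s *\<^sub>R (axis k 1 :: real ^ 'p))"
  define \<psi> where "\<psi> = frechet_derivative \<Phi> (at X) (axis k 1)"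
  define E where "E j = n0 (\<xi> j) * exp ((\<Phi> X $ j - \<phi>0 (\<xi> j)) / Te (\<xi> j))" for j
  define \<rho> where "\<rho> j = (\<Sum>l\<in>UNIV. w $ l * S (\<xi> j - X $ l))" for j
  define a where "a j = (fd_matrix dx *v \<Phi> X) $ j" for j
  have x0: "x 0 = X" by (simp add: x_def)
  have \<Phi>': "((\<lambda>s. \<Phi> (x s)) has_vector_derivative \<psi>) (at 0)"
  proof -
    have "(x has_derivative (\<lambda>s. s *\<^sub>R axis k 1)) (at 0)"
      unfolding x_def by (auto intro!: derivative_eq_intros)
    moreover have "(\<Phi> has_derivative frechet_derivative \<Phi> (at X)) (at (x 0))"
      using diff by (simp add: x0 frechet_derivative_works)
    ultimately have "((\<lambda>s. \<Phi> (x s)) has_derivative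
        (\<lambda>s. frechet_derivative \<Phi> (at X) (s *\<^sub>R axis k 1))) (at 0)"
      by (rule has_derivative_compose)
    moreover have "linear (frechet_derivative \<Phi> (at X))"
      using diff by (rule linear_frechet_derivative)
    ultimately show ?thesis
      by (simp add: has_vector_derivative_def \<psi>_def linear_scale)
  qed
  have \<Phi>j: "((\<lambda>s. \<Phi> (x s) $ j) has_real_derivative \<psi> $ j) (at 0)" for j
    unfolding has_real_derivative_iff_has_vector_derivative
    by (rule bounded_linear.has_vector_derivative[OF bounded_linear_vec_nth \<Phi>'])
  have Sl: "((\<lambda>s. S (\<xi> j - x s $ l)) has_real_derivative
      - S' (\<xi> j - X $ l) * axis k 1 $ l) (at 0)" for j l
  proof -
    have "((\<lambda>s. \<xi> j - x s $ l) has_real_derivative - axis k 1 $ l) (at 0)"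
      unfolding x_def by (auto intro!: derivative_eq_intros)
    from DERIV_chain2[OF S this] show ?thesis by (simp add: x0)
  qed
  have expj: "((\<lambda>s. exp ((\<Phi> (x s) $ j - \<phi>0 (\<xi> j)) / Te (\<xi> j))) has_real_derivative
      exp ((\<Phi> X $ j - \<phi>0 (\<xi> j)) / Te (\<xi> j)) * (\<psi> $ j / Te (\<xi> j))) (at 0)" for j
    by (rule derivative_eq_intros \<Phi>j refl | simp add: x0 Te)+
  have charge: "((\<lambda>s. w $ l * S (\<xi> j - x s $ l) * \<Phi> (x s) $ j) has_real_derivative
      w $ l * (- S' (\<xi> j - X $ l) * axis k 1 $ l) * \<Phi> X $ j
        + \<psi> $ j * (w $ l * S (\<xi> j - X $ l))) (at 0)" for j l
    using DERIV_mult[OF DERIV_cmult[OF Sl, of "w $ l"] \<Phi>j] unfolding x0 .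
  have quad: "((\<lambda>s. \<Phi> (x s) \<bullet> (fd_matrix dx *v \<Phi> (x s))) has_real_derivative
      2 * (\<psi> \<bullet> (fd_matrix dx *v \<Phi> X))) (at 0)"
    using has_derivative_fd_energy[OF \<Phi>'] by (simp add: x0)
  have "((\<lambda>s. hamiltonian L Z w S \<xi> n0 \<phi>0 Te \<Phi> (x s) V) has_real_derivative
      - (1 / 2) * (2 * (\<psi> \<bullet> (fd_matrix dx *v \<Phi> X))) * dx
      + Z * (\<Sum>j\<in>UNIV. dx * (\<Sum>l\<in>UNIV.
          w $ l * (- S' (\<xi> j - X $ l) * axis k 1 $ l) * \<Phi> X $ j + \<psi> $ j * (w $ l * S (\<xi> j - X $ l))))
      + 0
      - (\<Sum>j\<in>UNIV. dx * Te (\<xi> j) * n0 (\<xi> j) *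
          (exp ((\<Phi> X $ j - \<phi>0 (\<xi> j)) / Te (\<xi> j)) * (\<psi> $ j / Te (\<xi> j))))) (at 0)"
    unfolding hamiltonian_def Let_def dx_def[symmetric]
    by (intro DERIV_add DERIV_diff DERIV_sum DERIV_const DERIV_cmult DERIV_cmult_right quad expj
        charge)
  also have "- (1 / 2) * (2 * (\<psi> \<bullet> (fd_matrix dx *v \<Phi> X))) * dx = (\<Sum>j\<in>UNIV. - dx * \<psi> $ j * a j)"
    by (simp add: inner_vec_def a_def sum_distrib_left sum_negf mult.assoc mult.left_commute
        mult.commute[of _ dx])
  also have "(\<Sum>j\<in>UNIV. dx * (\<Sum>l\<in>UNIV.
          w $ l * (- S' (\<xi> j - X $ l) * axis k 1 $ l) * \<Phi> X $ j + \<psi> $ j * (w $ l * S (\<xi> j - X $ l))))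
      = (\<Sum>j\<in>UNIV. dx * (- (w $ k) * S' (\<xi> j - X $ k) * \<Phi> X $ j + \<psi> $ j * \<rho> j))"
    by (simp add: sum.distrib sum_distrib_left[symmetric] \<rho>_def axis_def
        if_distrib[of "\<lambda>x. _ * x"] if_distrib[of "\<lambda>x. x * _"] sum.delta cong: if_cong)
  also have "(\<Sum>j\<in>UNIV. dx * Te (\<xi> j) * n0 (\<xi> j) *
          (exp ((\<Phi> X $ j - \<phi>0 (\<xi> j)) / Te (\<xi> j)) * (\<psi> $ j / Te (\<xi> j))))
      = (\<Sum>j\<in>UNIV. dx * \<psi> $ j * E j)"
    by (intro sum.cong refl) (simp add: E_def Te)
  also have "(\<Sum>j\<in>UNIV. - dx * \<psi> $ j * a j)
        + Z * (\<Sum>j\<in>UNIV. dx * (- (w $ k) * S' (\<xi> j - X $ k) * \<Phi> X $ j + \<psi> $ j * \<rho> j)) + 0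
        - (\<Sum>j\<in>UNIV. dx * \<psi> $ j * E j)
      = (\<Sum>j\<in>UNIV. - (w $ k) * Z * (dx * S' (\<xi> j - X $ k) * \<Phi> X $ j)
            - dx * \<psi> $ j * (- Z * \<rho> j + a j + E j))"
    unfolding sum_distrib_left sum.distrib[symmetric] sum_subtractf[symmetric] add_0_right
    by (intro sum.cong refl) (simp add: algebra_simps)
  \<comment> \<open>The bracket multiplying \<open>\<psi>\<close> is the residual of the Poisson--Boltzmann equation.\<close>
  also have "\<dots> = (\<Sum>j\<in>UNIV. - (w $ k) * Z * (dx * S' (\<xi> j - X $ k) * \<Phi> X $ j))"
  proof -
    have "- Z * \<rho> j + a j + E j = 0" for j
      using PB unfolding discrete_poisson_boltzmann_def \<rho>_def a_def E_def dx_def by blast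
    then show ?thesis by simp
  qed
  also have "\<dots> = - (w $ k) * (Z * (\<Sum>j\<in>UNIV. dx * S' (\<xi> j - X $ k) * \<Phi> X $ j))"
    by (simp add: sum_distrib_left mult.assoc)
  finally show ?thesis
    unfolding partial_deriv_def x_def dx_def by (rule DERIV_imp_deriv)
qed

lemma solves_hamiltonian_iff_first_order:
  fixes \<xi> :: "'n::nontriv mod_ring \<Rightarrow> real"
    and \<Phi> :: "real ^ 'p \<Rightarrow> real ^ 'n mod_ring"
  assumes w: "\<And>k. w $ k \<noteq> 0"
    and S: "\<And>x. (S has_real_derivative S' x) (at x)"
    and Te: "\<And>j. Te (\<xi> j) \<noteq> 0"
    and PB: "\<And>x. discrete_poisson_boltzmann L Z w S \<xi> n0 \<phi>0 Te x (\<Phi> x)"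
    and diff: "\<And>x. \<Phi> differentiable (at x)"
  shows "solves_hamiltonian w (hamiltonian L Z w S \<xi> n0 \<phi>0 Te \<Phi>) I X V \<longleftrightarrow>
    (\<forall>t\<in>I. X differentiable (at t) \<and> V differentiable (at t) \<and>
      vector_derivative X (at t) = V t \<and>
      (\<forall>k. vector_derivative V (at t) $ k =
        Z * (\<Sum>j\<in>UNIV. grid_step L TYPE('n) * S' (\<xi> j - X t $ k) * \<Phi> (X t) $ j)))"
proof -
  have cancel: "1 / w $ k * (w $ k * a) = a" "- (1 / w $ k) * (- (w $ k) * a) = a" for k a
    using w[of k] by auto
  show ?thesis
    unfolding solves_hamiltonian_def partial_deriv_hamiltonian_velocity
      partial_deriv_hamiltonian_position[where L = L and Z = Z, OF S Te PB diff] cancel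
    unfolding vec_eq_iff by blast
qed

text \<open>
  A derivative of a curve is a linear map on \<open>real\<close>, hence multiplication by its value at \<open>1\<close>;
  this identifies the operator-valued derivative with the velocity vector. Openness makes the
  identification valid near each point, so that it can be differentiated once more.
\<close>

lemma twice_differentiable_on_curve_iff:
  fixes X :: "real \<Rightarrow> 'a::real_normed_vector"
  assumes "open I"
  shows "twice_differentiable_on X I \<longleftrightarrow>
    (\<forall>t\<in>I. X differentiable (at t) \<and> (\<lambda>s. vector_derivative X (at s)) differentiable (at t))"
    (is "_ \<longleftrightarrow> ?R")
proof
  assume "twice_differentiable_on X I"
  then obtain D where D: "\<And>t. t \<in> I \<Longrightarrow> (X has_derivative blinfun_apply (D t)) (at t)"
    and D': "\<And>t. t \<in> I \<Longrightarrow> D differentiable (at t)"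
    unfolding twice_differentiable_on_def by blast
  have vel: "vector_derivative X (at t) = D t 1" if "t \<in> I" for t
  proof (rule vector_derivative_at)
    have "D t s = s *\<^sub>R D t 1" for s
      using blinfun.scaleR_right[of "D t" s 1] by simp
    then have "blinfun_apply (D t) = (\<lambda>s. s *\<^sub>R D t 1)" by blast
    with D[OF that] show "(X has_vector_derivative D t 1) (at t)"
      by (simp add: has_vector_derivative_def)
  qed
  show ?R
  proof (intro ballI conjI)
    fix t assume t: "t \<in> I"
    show "X differentiable (at t)"
      using D[OF t] by (rule differentiableI)
    obtain D1 where "(D has_derivative D1) (at t)"
      using D'[OF t] unfolding differentiable_def by blast
    then have "((\<lambda>s. D s 1) has_derivative (\<lambda>h. D1 h 1)) (at t)"
      by (auto intro!: derivative_eq_intros)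
    then have "((\<lambda>s. vector_derivative X (at s)) has_derivative (\<lambda>h. D1 h 1)) (at t)"
      by (rule has_derivative_transform_within_open[OF _ \<open>open I\<close> t]) (simp add: vel)
    then show "(\<lambda>s. vector_derivative X (at s)) differentiable (at t)"
      by (rule differentiableI)
  qed
next
  assume R: ?R
  let ?D = "\<lambda>t. blinfun_scaleR_left (vector_derivative X (at t))"
  have "(X has_derivative blinfun_apply (?D t)) (at t)" if "t \<in> I" for t
  proof -
    have "(X has_vector_derivative vector_derivative X (at t)) (at t)"
      using R that by (simp add: vector_derivative_works[symmetric])
    then show ?thesis by (simp add: has_vector_derivative_def)
  qed
  moreover have "?D differentiable (at t)" if t: "t \<in> I" for t
  proof -
    have "(\<lambda>s. vector_derivative X (at s)) differentiable (at t)"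
      using R t by blast
    then obtain V' where "((\<lambda>s. vector_derivative X (at s)) has_derivative V') (at t)"
      unfolding differentiable_def by blast
    from bounded_linear.has_derivative[OF bounded_linear_blinfun_scaleR_left this]
    show ?thesis by (rule differentiableI)
  qed
  ultimately show "twice_differentiable_on X I"
    unfolding twice_differentiable_on_def by (intro exI[of _ ?D]) blast
qed

text \<open>
  By the chain rule the derivative of \<open>g \<circ> f\<close> at \<open>x\<close> is the operator product of the derivatives of
  \<open>g\<close> at \<open>f x\<close> and of \<open>f\<close> at \<open>x\<close>, a bounded bilinear expression in two differentiable maps.
\<close>

lemma twice_differentiable_on_compose:
  assumes g: "twice_differentiable_on g UNIV" and f: "twice_differentiable_on f U"
  shows "twice_differentiable_on (\<lambda>x. g (f x)) U"
proof -
  obtain Df where Df: "\<And>x. x \<in> U \<Longrightarrow> (f has_derivative blinfun_apply (Df x)) (at x)"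
    and Df': "\<And>x. x \<in> U \<Longrightarrow> Df differentiable (at x)"
    using f unfolding twice_differentiable_on_def by blast
  obtain Dg where Dg: "\<And>x. (g has_derivative blinfun_apply (Dg x)) (at x)"
    and Dg': "\<And>x. Dg differentiable (at x)"
    using g unfolding twice_differentiable_on_def by blast
  have "((\<lambda>x. g (f x)) has_derivative blinfun_apply (Dg (f x) o\<^sub>L Df x)) (at x)" if "x \<in> U" for x
    using has_derivative_compose[OF Df[OF that] Dg] by (simp add: blinfun_compose.rep_eq comp_def)
  moreover have "(\<lambda>x. Dg (f x) o\<^sub>L Df x) differentiable (at x)" if x: "x \<in> U" for x
  proof -
    obtain Df2 where Df2: "(Df has_derivative Df2) (at x)"
      using Df'[OF x] unfolding differentiable_def by blast
    obtain Dg2 where Dg2: "(Dg has_derivative Dg2) (at (f x))"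
      using Dg' unfolding differentiable_def by blast
    from bounded_bilinear.FDERIV[OF bounded_bilinear_blinfun_compose
        has_derivative_compose[OF Df[OF x] Dg2] Df2]
    show ?thesis by (rule differentiableI)
  qed
  ultimately show ?thesis
    unfolding twice_differentiable_on_def by (intro exI[of _ "\<lambda>x. Dg (f x) o\<^sub>L Df x"]) blast
qed

theorem theorem3p1:
  fixes L Z :: real
    and w :: "real ^ 'p"
    and S S' :: "real \<Rightarrow> real"
    and \<xi> :: "'n::nontriv mod_ring \<Rightarrow> real"
    and n0 \<phi>0 Te :: "real \<Rightarrow> real"
    and \<Phi> :: "real ^ 'p \<Rightarrow> real ^ 'n mod_ring"
    and I :: "real set"
  assumes N: "CARD('n) \<ge> 3"
    and L: "L > 0"
    and Z: "Z > 0"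
    and w: "\<forall>k. w $ k > 0"
    and grid: "\<forall>j. j \<noteq> 0 \<longrightarrow> \<xi> (j + 1) = \<xi> j + grid_step L TYPE('n)"
    and S_periodic: "\<forall>x. S (x + L) = S x"
    and S_deriv: "\<forall>x. (S has_real_derivative S' x) (at x)"
    and S'_cont: "continuous_on UNIV S'"
    and n0: "\<forall>j. n0 (\<xi> j) > 0"
    and Te: "\<forall>j. Te (\<xi> j) > 0"
    and PB_unique: "\<forall>X. \<exists>!\<phi> :: real ^ 'n mod_ring.
                      discrete_poisson_boltzmann L Z w S \<xi> n0 \<phi>0 Te X \<phi>"
    and \<Phi>: "\<forall>X. discrete_poisson_boltzmann L Z w S \<xi> n0 \<phi>0 Te X (\<Phi> X)"
    and \<Phi>_diff: "\<forall>X. \<Phi> differentiable (at X)"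
    and I: "open I" "is_interval I"
  shows "(\<forall>X V. solves_hamiltonian w (hamiltonian L Z w S \<xi> n0 \<phi>0 Te \<Phi>) I X V \<longrightarrow>
            (\<forall>t\<in>I. V t = vector_derivative X (at t)) \<and>
            solves_variational L Z w S S' \<xi> n0 \<phi>0 Te I X (\<lambda>t. \<Phi> (X t)) \<and>
            (twice_differentiable_on \<Phi> UNIV \<longrightarrow> twice_differentiable_on (\<lambda>t. \<Phi> (X t)) I)) \<and>
         (\<forall>X \<phi>. solves_variational L Z w S S' \<xi> n0 \<phi>0 Te I X \<phi> \<longrightarrow>
            (\<forall>t\<in>I. \<phi> t = \<Phi> (X t)) \<and>
            solves_hamiltonian w (hamiltonian L Z w S \<xi> n0 \<phi>0 Te \<Phi>) I X
              (\<lambda>t. vector_derivative X (at t)))"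
proof -
  let ?H = "hamiltonian L Z w S \<xi> n0 \<phi>0 Te \<Phi>"
  let ?force = "\<lambda>x k. Z * (\<Sum>j\<in>UNIV. grid_step L TYPE('n) * S' (\<xi> j - x $ k) * \<Phi> x $ j)"
  have w0: "w $ k \<noteq> 0" for k
    using w by (simp add: less_imp_neq[symmetric])
  have Te0: "Te (\<xi> j) \<noteq> 0" for j
    using Te by (simp add: less_imp_neq[symmetric])
  have first_order: "solves_hamiltonian w ?H I X V \<longleftrightarrow>
      (\<forall>t\<in>I. X differentiable (at t) \<and> V differentiable (at t) \<and>
        vector_derivative X (at t) = V t \<and> (\<forall>k. vector_derivative V (at t) $ k = ?force (X t) k))"
    for X V
    using S_deriv \<Phi> \<Phi>_diff by (intro solves_hamiltonian_iff_first_order w0 Te0) auto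
  have forward: "(\<forall>t\<in>I. V t = vector_derivative X (at t)) \<and>
      solves_variational L Z w S S' \<xi> n0 \<phi>0 Te I X (\<lambda>t. \<Phi> (X t)) \<and>
      (twice_differentiable_on \<Phi> UNIV \<longrightarrow> twice_differentiable_on (\<lambda>t. \<Phi> (X t)) I)"
    if "solves_hamiltonian w ?H I X V" for X V
  proof -
    have X: "X differentiable (at t)" and V: "V differentiable (at t)"
      and XV: "vector_derivative X (at t) = V t"
      and V': "vector_derivative V (at t) $ k = ?force (X t) k" if "t \<in> I" for t k
      using \<open>solves_hamiltonian w ?H I X V\<close> that unfolding first_order by auto
    \<comment> \<open>Hamilton's equations give \<open>X' = V\<close> on \<open>I\<close> only; since \<open>I\<close> is open, this suffices to
      transfer the derivative of \<open>V\<close> to \<open>X'\<close>.\<close>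
    have acc: "((\<lambda>s. vector_derivative X (at s)) has_vector_derivative vector_derivative V (at t))
        (at t)" if t: "t \<in> I" for t
      using V[OF t] unfolding vector_derivative_works
      by (rule has_vector_derivative_transform_within_open[OF _ I(1) t]) (simp add: XV)
    have X2: "twice_differentiable_on X I"
      unfolding twice_differentiable_on_curve_iff[OF I(1)]
      using X acc differentiableI_vector by blast
    have "(\<lambda>t. \<Phi> (X t)) differentiable (at t)" if "t \<in> I" for t
      using \<Phi>_diff X[OF that] by (auto intro: differentiable_compose)
    then have "solves_variational L Z w S S' \<xi> n0 \<phi>0 Te I X (\<lambda>t. \<Phi> (X t))"
      unfolding solves_variational_def
      using X2 V' \<Phi> vector_derivative_at[OF acc] by simp
    then show ?thesis
      using XV X2 twice_differentiable_on_compose by auto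
  qed
  have backward: "(\<forall>t\<in>I. \<phi> t = \<Phi> (X t)) \<and>
      solves_hamiltonian w ?H I X (\<lambda>t. vector_derivative X (at t))"
    if "solves_variational L Z w S S' \<xi> n0 \<phi>0 Te I X \<phi>" for X \<phi>
  proof -
    have eq: "\<phi> t = \<Phi> (X t)" if "t \<in> I" for t
      using PB_unique \<Phi> \<open>solves_variational L Z w S S' \<xi> n0 \<phi>0 Te I X \<phi>\<close> that
      unfolding solves_variational_def by blast
    with that show ?thesis
      unfolding first_order solves_variational_def twice_differentiable_on_curve_iff[OF I(1)]
      by auto
  qed
  show ?thesis
    using forward backward by blast
qed

end
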